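(* Let $p$ be a prime, $k\ge1$, $q=p^k$. Every integer of the form $$D=AB^{q-1},$$ where $A,B\in\mathbb Z$ satisfy $(q-1)^2\mid A$ and $B\equiv A\pmod q$, is an integer group determinant of $GA(1,q)$.
   Context: For a finite group $G=\{g_1,\dots,g_n\}$ and an element $\sum_{g\in G}a_g g$ of the group ring $\mathbb Z[G]$ (all $a_g\in\mathbb Z$), the group determinant is $D\left(\sum_{g\in G}a_g g\right)=\det\left(a_{g_ig_j^{-1}}\right)_{i,j=1}^n$. An integer group determinant of $G$ is any integer of this form. The general affine group of degree one over $\mathbb F_q$ is $GA(1,q)=\left\{\begin{pmatrix} a & b\\ 0 & 1\end{pmatrix}: a\in\mathbb F_q^*,\ b\in\mathbb F_q\right\}$ under matrix multiplication. *)

theory Defs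
  imports "HOL-Algebra.Group" "HOL-Combinatorics.Permutations" "HOL-Number_Theory.Cong"
begin

text \<open>Group determinant of a finite group G (HOL-Algebra structure) for coefficients
  a : G -> Z, via the Leibniz expansion of det (a (g_i g_j^{-1}))_{i,j}, with the
  rows/columns indexed directly by the elements of G.\<close>
definition group_det :: "('g, 'm) monoid_scheme \<Rightarrow> ('g \<Rightarrow> int) \<Rightarrow> int" where
  "group_det G a =
     (\<Sum>\<sigma> | \<sigma> permutes carrier G.
        sign \<sigma> * (\<Prod>g\<in>carrier G. a (g \<otimes>\<^bsub>G\<^esub> inv\<^bsub>G\<^esub> (\<sigma> g))))"

definition integer_group_det :: "('g, 'm) monoid_scheme \<Rightarrow> int \<Rightarrow> bool" where
  "integer_group_det G D \<longleftrightarrow> (\<exists>a :: 'g \<Rightarrow> int. D = group_det G a)"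

text \<open>GA(1,F): pairs (a,b) standing for the matrix [[a,b],[0,1]], a nonzero;
  matrix multiplication gives (a,b)(c,d) = (ac, ad+b).\<close>
definition GA1 :: "('a::field \<times> 'a) monoid" where
  "GA1 = \<lparr> carrier = {(a, b). a \<noteq> 0},
           monoid.mult = (\<lambda>(a, b) (c, d). (a * c, a * d + b)),
           monoid.one = (1, 0) \<rparr>"

end

theory Submission
  imports Defs "Jordan_Normal_Form.Determinant" "HOL-Algebra.Multiplicative_Group"
    "HOL-Library.Cardinality"
begin

text \<open>Write \<open>n = q - 1\<close> and let \<open>\<gamma>\<close> generate the multiplicative group of the field. The regular
  representation of the affine group is, over the rationals, the regular representation of the
  multiplicative group plus \<open>n\<close> copies of the degree \<open>n\<close> representation on functions on the line
  modulo constants, so a group determinant is a product \<open>D\<^sub>0 * D\<^sub>1 ^ n\<close>. For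
  \<open>1 - (\<gamma>, 0)\<close> plus a suitable combination of sums over point stabiliser cosets, both
  representations send the element to a matrix \<open>1 - P + u w\<^sup>T\<close> with \<open>P\<close> an \<open>n\<close>-cycle, whose
  determinant is \<open>(\<Sum> u) * (\<Sum> w)\<close>. On the quotient \<open>u = 1\<close> and \<open>w = m\<close> are constant, giving
  \<open>D\<^sub>0 = n\<^sup>2 * m\<close>. On the other representation one may alter \<open>u\<close> and \<open>w\<close> modulo \<open>q\<close>: lowering one
  entry of \<open>u\<close> by \<open>q\<close> makes \<open>\<Sum> u = -1\<close>, and lowering one entry of \<open>w\<close> by \<open>q * r\<close> gives
  \<open>D\<^sub>1 = q * r - n * m\<close>, which is an arbitrary integer congruent to \<open>D\<^sub>0\<close> modulo \<open>q\<close>.\<close>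

section \<open>Determinant identities\<close>

text \<open>Conjugation by the enumeration \<open>e\<close> is a sign-preserving bijection from the
  permutations of the indices to those of the group, so the two Leibniz expansions agree term by
  term.\<close>

lemma group_det_eq_det:
  assumes e: "bij_betw e {0..<N} (carrier G)"
  shows "group_det G a = det (mat N N (\<lambda>(i, j). a (e i \<otimes>\<^bsub>G\<^esub> inv\<^bsub>G\<^esub> e j)))"
proof -
  let ?conj = "\<lambda>\<pi> x. if x \<in> carrier G then e (\<pi> (inv_into {0..<N} e x)) else x"
  have inj: "inj_on e {0..<N}" and im: "e ` {0..<N} = carrier G"
    using e by (auto simp: bij_betw_def)
  have "group_det G a = (\<Sum>\<pi> | \<pi> permutes {0..<N}.
      sign (?conj \<pi>) * (\<Prod>g\<in>carrier G. a (g \<otimes>\<^bsub>G\<^esub> inv\<^bsub>G\<^esub> (?conj \<pi> g))))"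
    unfolding group_det_def
    by (rule sum.reindex_bij_betw[OF bij_betw_permutations[OF e], symmetric])
  also have "\<dots> = (\<Sum>\<pi> | \<pi> permutes {0..<N}.
      sign \<pi> * (\<Prod>i = 0..<N. a (e i \<otimes>\<^bsub>G\<^esub> inv\<^bsub>G\<^esub> e (\<pi> i))))"
  proof (rule sum.cong[OF refl])
    fix \<pi> assume "\<pi> \<in> {\<pi>. \<pi> permutes {0..<N}}"
    then have \<pi>: "\<pi> permutes {0..<N}" by simp
    have "?conj \<pi> = map_permutation {0..<N} e \<pi>"
      by (auto simp: map_permutation_def restrict_id_def im fun_eq_iff)
    then have "sign (?conj \<pi>) = sign \<pi>"
      using sign_map_permutation[OF inj \<pi>] by simp
    moreover have "(\<Prod>g\<in>carrier G. a (g \<otimes>\<^bsub>G\<^esub> inv\<^bsub>G\<^esub> (?conj \<pi> g)))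
        = (\<Prod>i = 0..<N. a (e i \<otimes>\<^bsub>G\<^esub> inv\<^bsub>G\<^esub> (?conj \<pi> (e i))))"
      by (rule prod.reindex_bij_betw[OF e, symmetric])
    moreover have "\<dots> = (\<Prod>i = 0..<N. a (e i \<otimes>\<^bsub>G\<^esub> inv\<^bsub>G\<^esub> e (\<pi> i)))"
      by (rule prod.cong) (use im inj in \<open>auto simp: inv_into_f_f\<close>)
    ultimately show "sign (?conj \<pi>) * (\<Prod>g\<in>carrier G. a (g \<otimes>\<^bsub>G\<^esub> inv\<^bsub>G\<^esub> (?conj \<pi> g)))
      = sign \<pi> * (\<Prod>i = 0..<N. a (e i \<otimes>\<^bsub>G\<^esub> inv\<^bsub>G\<^esub> e (\<pi> i)))"
      by simp
  qed
  also have "\<dots> = det (mat N N (\<lambda>(i, j). a (e i \<otimes>\<^bsub>G\<^esub> inv\<^bsub>G\<^esub> e j)))"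
    by (subst det_def'[of _ N], simp, intro sum.cong refl arg_cong2[of _ _ _ _ "(*)"] prod.cong)
      (auto simp: permutes_in_image)
  finally show ?thesis .
qed

text \<open>The index \<open>c * n + i\<close> stands for row \<open>i\<close> of block
  \<open>c\<close>; the induction splits off the last block.\<close>

lemma det_block_diagonal:
  fixes K :: "nat \<Rightarrow> nat \<Rightarrow> nat \<Rightarrow> 'a::idom"
  shows "det (mat (c * n) (c * n) (\<lambda>(i, j).
      if i div n = j div n then K (i div n) (i mod n) (j mod n) else 0))
    = (\<Prod>d<c. det (mat n n (\<lambda>(i, j). K d i j)))"
proof (induction c)
  case (Suc c)
  let ?B = "\<lambda>c. mat (c * n) (c * n) (\<lambda>(i, j).
      if i div n = j div n then K (i div n) (i mod n) (j mod n) else 0)"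
  have div_eq: "i div n = c" "i mod n = i - c * n" if "c * n \<le> i" "i < n + c * n" for i
  proof -
    show "i div n = c" using that by (intro div_nat_eqI) (auto simp: mult.commute)
    then show "i mod n = i - c * n" by (metis minus_div_mult_eq_mod)
  qed
  have "?B (Suc c) = four_block_mat (?B c) (0\<^sub>m (c * n) n) (0\<^sub>m n (c * n))
      (mat n n (\<lambda>(i, j). K c i j))" (is "_ = ?F")
  proof (rule eq_matI, goal_cases)
    case (1 i j)
    then have ij: "i < n + c * n" "j < n + c * n" by auto
    have less: "l div n < c" if "l < c * n" for l
      using that by (rule less_mult_imp_div_less)
    show ?case
      using ij less[of i] less[of j] div_eq[of i] div_eq[of j]
      by (cases "i < c * n"; cases "j < c * n") simp_all
  qed simp_all
  then have "det (?B (Suc c)) = det (?B c) * det (mat n n (\<lambda>(i, j). K c i j))"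
    by (simp only: det_four_block_mat_lower_left_zero[OF mat_carrier zero_carrier_mat refl mat_carrier])
  then show ?case using Suc.IH by simp
qed simp

lemma sum_of_bool_cycle:
  assumes "i < n"
  shows "(\<Sum>j<n. of_bool (i = Suc j mod n)) = (1 :: 'a::semiring_1)"
proof -
  obtain k where n: "n = Suc k" using assms by (cases n) auto
  have "(\<Sum>j<k. of_bool (i = Suc j mod n)) = (\<Sum>j<k. of_bool (i = Suc j) :: 'a)"
    by (rule sum.cong) (auto simp: n)
  then have "(\<Sum>j<n. of_bool (i = Suc j mod n)) = (\<Sum>j<k. of_bool (i = Suc j)) + (of_bool (i = 0) :: 'a)"
    by (simp add: n)
  then show ?thesis using assms n by (cases i) (simp_all add: of_bool_def)
qed

text \<open>For the permutation matrix P of the cycle, 1 - P is singular and its adjugate is the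
  all-ones matrix, so the matrix determinant lemma predicts this product. The proof obtains it from
  the factorisation \<open>K * R = L * T * V\<close> into triangular matrices.\<close>

lemma det_one_minus_cycle_plus_rank_one:
  fixes u w :: "nat \<Rightarrow> 'a::idom"
  assumes "n > 0"
  shows "det (mat n n (\<lambda>(i, j). of_bool (i = j) - of_bool (i = Suc j mod n) + u i * w j))
    = (\<Sum>i<n. u i) * (\<Sum>j<n. w j)"
proof -
  obtain k where n: "n = Suc k" using assms by (cases n) auto
  define K where "K = mat n n (\<lambda>(i, j). of_bool (i = j) - of_bool (i = Suc j mod n) + u i * w j)"
  \<comment> \<open>\<open>R\<close> adds all columns of \<open>K\<close> to the last one, which becomes a multiple of \<open>u\<close>;
    in the result this multiple and the rank-one part split off as \<open>V\<close>.\<close>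
  define R :: "'a mat" where "R = mat n n (\<lambda>(i, j). of_bool (i = j \<or> j = k))"
  define L :: "'a mat" where "L = mat n n (\<lambda>(i, j). of_bool (i = j) - of_bool (i = Suc j))"
  \<comment> \<open>The last column holds partial sums of \<open>u\<close>; the row differences
    taken by \<open>L\<close> turn it back into \<open>u\<close>. The corner entry is the full
    sum.\<close>
  define T where "T = mat n n (\<lambda>(i, j). if j = k then (\<Sum>l\<le>i. u l) else of_bool (i = j))"
  define V where "V = mat n n (\<lambda>(i, j). if i < k then of_bool (i = j)
      else if j = k then (\<Sum>l<n. w l) else w j)"
  have carrier: "K \<in> carrier_mat n n" "R \<in> carrier_mat n n" "L \<in> carrier_mat n n"
    "T \<in> carrier_mat n n" "V \<in> carrier_mat n n"
    by (auto simp: K_def R_def L_def T_def V_def)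
  have LT: "L * T = mat n n (\<lambda>(i, j). if j = k then u i else of_bool (i = j) - of_bool (i = Suc j))"
  proof (rule eq_matI, goal_cases)
    case (1 i j)
    then have ij: "i < n" "j < n" by auto
    have "(L * T) $$ (i, j) = (\<Sum>l = 0..<n. (of_bool (i = l) - of_bool (i = Suc l)) * T $$ (l, j))"
      using ij by (simp add: L_def T_def scalar_prod_def)
    also have "\<dots> = T $$ (i, j) - (\<Sum>l = 0..<n. of_bool (i = Suc l) * T $$ (l, j))"
      using ij by (simp add: left_diff_distrib sum_subtractf of_bool_def if_distrib[of "\<lambda>x. x * _"]
          cong: if_cong)
    also have "(\<Sum>l = 0..<n. of_bool (i = Suc l) * T $$ (l, j))
        = (case i of 0 \<Rightarrow> 0 | Suc i' \<Rightarrow> T $$ (i', j))"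
      using ij by (cases i) (simp_all add: of_bool_def if_distrib[of "\<lambda>x. x * _"] cong: if_cong)
    finally show ?case
      using ij by (auto simp: T_def split: nat.splits)
  qed (simp_all add: L_def T_def)
  have "K * R = L * T * V"
  proof (rule eq_matI, goal_cases)
    case (1 i j)
    then have ij: "i < n" "j < n" by (auto simp: L_def V_def)
    have "(L * T * V) $$ (i, j) = (\<Sum>l = 0..<n. (L * T) $$ (i, l) * V $$ (l, j))"
      using ij carrier by (simp add: scalar_prod_def del: assoc_mult_mat)
    also have "\<dots> = (\<Sum>l = 0..<k. (of_bool (i = l) - of_bool (i = Suc l)) * of_bool (l = j))
        + u i * V $$ (k, j)"
      unfolding LT n using ij by (simp add: V_def n)
    also have "\<dots> = (if j = k then 0 else of_bool (i = j) - of_bool (i = Suc j)) + u i * V $$ (k, j)"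
      using ij by (auto simp: n if_distrib[of "\<lambda>x. _ * x"] of_bool_def cong: if_cong)
    finally have right: "(L * T * V) $$ (i, j)
      = (if j = k then 0 else of_bool (i = j) - of_bool (i = Suc j)) + u i * V $$ (k, j)" .
    have left: "(K * R) $$ (i, j) = (\<Sum>l = 0..<n. K $$ (i, l) * of_bool (l = j \<or> j = k))"
      using ij by (simp add: K_def R_def scalar_prod_def)
    show ?case
    proof (cases "j = k")
      case True
      \<comment> \<open>The row sums of the identity and of the cycle cancel, leaving only the
        rank-one part.\<close>
      have "(\<Sum>l = 0..<n. K $$ (i, l))
        = (\<Sum>l = 0..<n. of_bool (i = l)) - (\<Sum>l = 0..<n. of_bool (i = Suc l mod n))
          + u i * (\<Sum>l = 0..<n. w l)"
        using ij by (simp add: K_def sum.distrib sum_subtractf sum_distrib_left)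
      also have "(\<Sum>l = 0..<n. of_bool (i = l)) = (1 :: 'a)"
        using ij by (simp add: of_bool_def)
      also have "(\<Sum>l = 0..<n. of_bool (i = Suc l mod n)) = (1 :: 'a)"
        using sum_of_bool_cycle[OF ij(1)] by (simp only: lessThan_atLeast0)
      finally show ?thesis
        using True left right ij by (simp add: V_def lessThan_atLeast0)
    next
      case False
      then have "(K * R) $$ (i, j) = K $$ (i, j)"
        unfolding left using ij
        by (simp add: if_distrib[of "\<lambda>x. _ * x"] of_bool_def cong: if_cong)
      then show ?thesis
        using False right ij by (simp add: K_def V_def n)
    qed
  qed (simp_all add: K_def R_def L_def V_def)
  then have "det (K * R) = det (L * T * V)" by simp
  then have "det K * det R = det L * det T * det V"
    by (simp add: det_mult[OF carrier(1,2)] det_mult[OF carrier(3,4)]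
        det_mult[OF mult_carrier_mat[OF carrier(3,4)] carrier(5)] del: assoc_mult_mat)
  moreover have "det R = 1"
    by (subst det_upper_triangular[OF _ carrier(2)])
      (auto simp: R_def n prod_list_diag_prod upper_triangular_def)
  moreover have "det L = 1"
    by (subst det_lower_triangular[OF _ carrier(3)]) (auto simp: L_def prod_list_diag_prod)
  moreover have "det T = (\<Sum>i<n. u i)"
    by (subst det_upper_triangular[OF _ carrier(4)])
      (auto simp: T_def n prod_list_diag_prod upper_triangular_def lessThan_Suc_atMost)
  moreover have "det V = (\<Sum>j<n. w j)"
    by (subst det_lower_triangular[OF _ carrier(5)]) (auto simp: V_def n prod_list_diag_prod)
  ultimately show ?thesis by (simp add: K_def)
qed

section \<open>A generator of the multiplicative group\<close>

lemma finite_field_generator: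
  obtains \<gamma> :: "'a::{finite, field}"
  where "\<gamma> ^ (CARD('a) - 1) = 1" "bij_betw (\<lambda>j. \<gamma> ^ j) {0..<CARD('a) - 1} (UNIV - {0})"
proof -
  let ?n = "CARD('a) - 1"
  define R :: "'a ring" where "R = \<lparr>carrier = UNIV, monoid.mult = (*), one = 1, zero = 0, add = (+)\<rparr>"
  have "field R"
    by (unfold_locales)
      (auto simp: R_def Units_def algebra_simps intro: exI[of _ "- x" for x] exI[of _ "inverse x" for x] left_inverse right_inverse)
  then obtain \<gamma> where \<gamma>: "\<gamma> \<in> carrier (mult_of R)"
    and gen: "carrier (mult_of R) = {\<gamma> [^]\<^bsub>R\<^esub> i | i::nat. i \<in> UNIV}"
    using field.finite_field_mult_group_has_gen[of R] by (auto simp: R_def)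
  have pow: "\<gamma> [^]\<^bsub>R\<^esub> i = \<gamma> ^ i" for i :: nat
    by (induction i) (simp_all add: R_def nat_pow_def)
  have [simp]: "\<gamma> \<noteq> 0" using \<gamma> by (simp add: R_def)
  have carrier: "carrier (mult_of R) = UNIV - {0}" by (simp add: R_def)
  have units: "UNIV - {0} = range (\<lambda>i. \<gamma> ^ i)"
    using gen unfolding pow carrier by (simp add: full_SetCompr_eq)
  \<comment> \<open>Multiplication by \<open>\<gamma>\<close> permutes the units; cancelling their
    product gives the exponent.\<close>
  have "(\<Prod>y\<in>UNIV - {0}. y) = (\<Prod>y\<in>UNIV - {0}. \<gamma> * y)"
    by (rule prod.reindex_bij_betw[symmetric], rule bij_betwI[of _ _ _ "\<lambda>y. y / \<gamma>"]) auto
  also have "\<dots> = \<gamma> ^ ?n * (\<Prod>y\<in>UNIV - {0}. y)"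
    by (simp add: prod.distrib)
  finally have one: "\<gamma> ^ ?n = 1" by simp
  have "CARD('a) \<ge> 2"
    using card_mono[of "UNIV :: 'a set" "{0, 1}"] by simp
  then have n: "?n > 0" by simp
  have "\<gamma> ^ i \<in> (\<lambda>j. \<gamma> ^ j) ` {0..<?n}" for i
  proof (rule image_eqI)
    have "\<gamma> ^ i = \<gamma> ^ (?n * (i div ?n) + i mod ?n)" by simp
    also have "\<dots> = \<gamma> ^ (i mod ?n)" unfolding power_add power_mult one by simp
    finally show "\<gamma> ^ i = \<gamma> ^ (i mod ?n)" .
  qed (use n in simp)
  then have "range (\<lambda>i. \<gamma> ^ i) = (\<lambda>j. \<gamma> ^ j) ` {0..<?n}" by blast
  then have im: "(\<lambda>j. \<gamma> ^ j) ` {0..<?n} = UNIV - {0}" using units by simp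
  \<comment> \<open>As many exponents as units, so the surjection is injective.\<close>
  then have "card ((\<lambda>j. \<gamma> ^ j) ` {0..<?n}) = card {0..<?n}" by simp
  then have "bij_betw (\<lambda>j. \<gamma> ^ j) {0..<?n} (UNIV - {0})"
    using im by (simp add: bij_betw_def eq_card_imp_inj_on)
  then show thesis using that one by blast
qed

section \<open>The affine group acting on the line\<close>

lemma carrier_GA1: "carrier GA1 = (UNIV - {0}) \<times> (UNIV :: 'a::field set)"
  by (auto simp: GA1_def)

lemma mult_GA1: "s \<otimes>\<^bsub>GA1\<^esub> g = (fst s * fst g, fst s * snd g + snd s)"
  by (simp add: GA1_def split_def)

lemma group_GA1: "group (GA1 :: ('a::field \<times> 'a) monoid)"
proof (rule groupI)
  fix s :: "'a \<times> 'a" assume "s \<in> carrier GA1"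
  then show "\<exists>g\<in>carrier GA1. g \<otimes>\<^bsub>GA1\<^esub> s = \<one>\<^bsub>GA1\<^esub>"
    by (intro bexI[of _ "(1 / fst s, - snd s / fst s)"]) (auto simp: GA1_def)
qed (auto simp: GA1_def algebra_simps)

definition affine_act :: "'a::field \<times> 'a \<Rightarrow> 'a \<Rightarrow> 'a" where
  "affine_act s y = fst s * y + snd s"

lemma affine_act_mult: "affine_act (s \<otimes>\<^bsub>GA1\<^esub> g) y = affine_act s (affine_act g y)"
  by (simp add: affine_act_def mult_GA1 algebra_simps)

text \<open>An affine map is determined by its slope and the image of one point, and both can be
  prescribed freely.\<close>

lemma sum_GA1_fst_act:
  fixes y :: "'a::{finite, field}"
  shows "(\<Sum>s\<in>carrier GA1. F (fst s) (affine_act s y)) = (\<Sum>h\<in>UNIV - {0}. \<Sum>c\<in>UNIV. F h c)"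
proof -
  have "bij_betw (\<lambda>s. (fst s, affine_act s y)) (carrier GA1) ((UNIV - {0}) \<times> UNIV)"
    by (rule bij_betwI[of _ _ _ "\<lambda>(h, c). (h, c - h * y)"])
      (auto simp: carrier_GA1 affine_act_def)
  from sum.reindex_bij_betw[OF this, of "\<lambda>(h, c). F h c"] show ?thesis
    by (simp add: sum.cartesian_product)
qed

text \<open>This is sharp 2-transitivity: exactly one affine map sends two distinct points to two
  prescribed distinct points.\<close>

lemma sum_GA1_act_act:
  fixes y t :: "'a::{finite, field}"
  assumes "y \<noteq> t"
  shows "(\<Sum>s\<in>carrier GA1. F (affine_act s y) (affine_act s t)) = (\<Sum>c\<in>UNIV. \<Sum>d\<in>UNIV - {c}. F c d)"
proof -
  \<comment> \<open>\<open>solve\<close> and \<open>slope\<close> verify that interpolation through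
    (y, c) and (t, d) inverts the evaluation map.\<close>
  have solve: "(c - d) * t / (y - t) + (c - (c - d) * y / (y - t)) = d" for c d
  proof -
    have "(c - d) * t / (y - t) + (c - (c - d) * y / (y - t)) = c - (c - d) / (y - t) * (y - t)"
      by (simp only: right_diff_distrib) simp
    then show ?thesis using assms by simp
  qed
  have slope: "(a * y - a * t) / (y - t) = a" "(a * y - a * t) * y / (y - t) = a * y" for a
    using assms by (simp_all add: right_diff_distrib[symmetric])
  have "bij_betw (\<lambda>s. (affine_act s y, affine_act s t)) (carrier GA1) (SIGMA c:UNIV. UNIV - {c})"
    by (rule bij_betwI[of _ _ _ "\<lambda>(c, d). ((c - d) / (y - t), c - (c - d) / (y - t) * y)"])
      (use assms in \<open>auto simp: carrier_GA1 affine_act_def solve slope\<close>)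
  from sum.reindex_bij_betw[OF this, of "\<lambda>(c, d). F c d"] show ?thesis
    by (simp add: sum.Sigma)
qed

section \<open>The coefficients and their two representations\<close>

text \<open>The coordinate \<open>f z - f 0\<close> of a function \<open>f\<close> modulo constants,
  taken at the indicator of \<open>t\<close>.\<close>

definition point_diff :: "'a::field \<Rightarrow> 'a \<Rightarrow> int" where
  "point_diff z t = of_bool (t = z) - of_bool (t = 0)"

text \<open>On the units this is minus the vector u: all ones, lowered by q at the point 1. The
  value 0 at the point 0 makes the total 1.\<close>

definition point_weight :: "'a::{finite, field} \<Rightarrow> int" where
  "point_weight y = int CARD('a) * of_bool (y = 1) - of_bool (y \<noteq> 0)"

text \<open>On the degree \<open>q - 1\<close> representation the two weighted sums act with rank one; their
  total mass \<open>m\<close> is seen by the quotient, while \<open>r\<close> moves mass between the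
  base points \<open>0\<close> and \<open>1\<close> and shifts the determinant there by multiples of \<open>q\<close>.\<close>

definition ga_coeffs :: "'a::{finite, field} \<Rightarrow> int \<Rightarrow> int \<Rightarrow> 'a \<times> 'a \<Rightarrow> int" where
  "ga_coeffs \<gamma> m r s = of_bool (s = (1, 0)) - of_bool (s = (\<gamma>, 0))
     + (m - r) * point_weight (affine_act s 0) + r * point_weight (affine_act s 1)"

lemma int_card_units: "int (card (UNIV - {0 :: 'a::{finite, field}})) = int CARD('a) - 1"
  by (simp add: of_nat_diff Suc_leI)

lemma sum_point_diff: "(\<Sum>t\<in>UNIV. point_diff z t) = 0" for z :: "'a::{finite, field}"
  by (simp add: point_diff_def sum_subtractf)

lemma sum_point_weight: "(\<Sum>y\<in>UNIV. point_weight (y :: 'a::{finite, field})) = 1"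
proof -
  have "(\<Sum>y\<in>UNIV. point_weight (y :: 'a)) = (\<Sum>y\<in>UNIV. int CARD('a) * of_bool (y = 1) - 1 + of_bool (y = (0 :: 'a)))"
    by (rule sum.cong) (auto simp: point_weight_def)
  then show ?thesis by (simp add: sum.distrib sum_subtractf sum_distrib_left[symmetric])
qed

lemma sum_point_weight_point_diff:
  fixes z :: "'a::{finite, field}"
  assumes "z \<noteq> 0"
  shows "(\<Sum>c\<in>UNIV. point_weight c * point_diff z c) = int CARD('a) * of_bool (z = 1) - 1"
proof -
  \<comment> \<open>The indicator at 0 drops out because \<open>point_weight\<close> vanishes
    there.\<close>
  have "point_weight c * point_diff z c = (if c = z then point_weight z else 0)" for c :: 'a
    by (simp add: point_weight_def point_diff_def)
  then show ?thesis using assms by (simp add: point_weight_def)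
qed

text \<open>The result separates into a factor in \<open>z\<close> and a factor in \<open>t\<close>,
  which is the rank-one action. For \<open>y = t\<close> each slope contributes the same pairing;
  otherwise 2-transitivity applies, and summing \<open>point_diff\<close> over all points but
  \<open>c\<close> gives minus its value at \<open>c\<close>.\<close>

lemma sum_point_weight_act_point_diff:
  fixes y t z :: "'a::{finite, field}"
  assumes z: "z \<noteq> 0"
  shows "(\<Sum>s\<in>carrier GA1. point_weight (affine_act s y) * point_diff z (affine_act s t))
    = (int CARD('a) * of_bool (z = 1) - 1) * (int CARD('a) * of_bool (y = t) - 1)"
proof (cases "y = t")
  case True
  have "(\<Sum>s\<in>carrier GA1. point_weight (affine_act s t) * point_diff z (affine_act s t))
    = (\<Sum>h\<in>UNIV - {0 :: 'a}. \<Sum>c\<in>UNIV. point_weight c * point_diff z c)"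
    by (rule sum_GA1_fst_act)
  also have "\<dots> = (int CARD('a) - 1) * (int CARD('a) * of_bool (z = 1) - 1)"
    by (simp only: sum_point_weight_point_diff[OF z] sum_constant int_card_units)
  finally show ?thesis using True by (simp add: mult.commute)
next
  case False
  have "(\<Sum>s\<in>carrier GA1. point_weight (affine_act s y) * point_diff z (affine_act s t))
    = (\<Sum>c\<in>UNIV. point_weight c * (\<Sum>d\<in>UNIV - {c}. point_diff z d))"
    by (simp add: sum_GA1_act_act[OF False, of "\<lambda>c d. point_weight c * point_diff z d"] sum_distrib_left)
  also have "\<dots> = - (\<Sum>c\<in>UNIV. point_weight c * point_diff z c)"
    by (simp add: sum_diff1 sum_point_diff sum_negf)
  finally show ?thesis using False sum_point_weight_point_diff[OF z] by simp
qed

lemma sum_GA1_ga_coeffs: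
  assumes "\<gamma> \<noteq> 0"
  shows "(\<Sum>s\<in>carrier GA1. ga_coeffs \<gamma> m r s * F s) = F (1, 0) - F (\<gamma>, 0)
    + (m - r) * (\<Sum>s\<in>carrier GA1. point_weight (affine_act s 0) * F s)
    + r * (\<Sum>s\<in>carrier GA1. point_weight (affine_act s 1) * F s)"
proof -
  have delta: "(\<Sum>s\<in>carrier GA1. of_bool (s = (h, 0)) * F s) = F (h, 0)" if "h \<noteq> 0" for h
    using that sum.delta[of "carrier GA1" "(h, 0)" F]
    by (simp add: carrier_GA1 of_bool_def if_distrib[of "\<lambda>x. x * _"] cong: if_cong)
  show ?thesis
    unfolding ga_coeffs_def
    using assms
    by (simp add: distrib_right left_diff_distrib mult.assoc sum.distrib sum_subtractf
        sum_distrib_left[symmetric] delta del: sum_of_bool_mult_eq)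
qed

lemma ga_coeffs_point_diff:
  fixes \<gamma> z t :: "'a::{finite, field}"
  assumes "\<gamma> \<noteq> 0" "z \<noteq> 0"
  shows "(\<Sum>s\<in>carrier GA1. ga_coeffs \<gamma> m r s * point_diff z (affine_act s t))
    = point_diff z t - point_diff z (\<gamma> * t)
      + (int CARD('a) * of_bool (z = 1) - 1)
        * ((m - r) * (int CARD('a) * of_bool (t = 0) - 1) + r * (int CARD('a) * of_bool (t = 1) - 1))"
  using assms
  by (simp add: sum_GA1_ga_coeffs sum_point_weight_act_point_diff) (simp add: affine_act_def algebra_simps)

lemma ga_coeffs_fst:
  fixes \<gamma> h z :: "'a::{finite, field}"
  assumes "\<gamma> \<noteq> 0" "h \<noteq> 0" "z \<noteq> 0"
  shows "(\<Sum>s\<in>carrier GA1. ga_coeffs \<gamma> m r s * of_bool (fst s * h = z))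
    = of_bool (h = z) - of_bool (\<gamma> * h = z) + m"
proof -
  \<comment> \<open>At a fixed slope the image of \<open>y\<close> runs over the whole line, so only
    the total weight 1 is seen, whatever \<open>y\<close> is.\<close>
  have "(\<Sum>s\<in>carrier GA1. point_weight (affine_act s y) * of_bool (fst s * h = z)) = 1" for y
  proof -
    have "(\<Sum>s\<in>carrier GA1. point_weight (affine_act s y) * of_bool (fst s * h = z))
      = (\<Sum>a\<in>UNIV - {0}. if a = z / h then 1 else 0)"
      unfolding sum_GA1_fst_act[of "\<lambda>a c. point_weight c * of_bool (a * h = z)"] sum_distrib_right[symmetric] sum_point_weight
      by (rule sum.cong) (use assms in \<open>auto simp: field_simps\<close>)
    then show ?thesis using assms by (subst (asm) sum.delta) auto
  qed
  then show ?thesis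
    using assms by (simp add: sum_GA1_ga_coeffs del: sum_of_bool_mult_eq sum_mult_of_bool_eq)
qed

section \<open>Independence of the functionals\<close>

text \<open>Affine maps of different slopes agree at one point, distinct ones of equal slope
  nowhere. Hence slopes and point images together detect \<open>s = g\<close>.\<close>

lemma sum_agree:
  fixes s g :: "'a::{finite, field} \<times> 'a"
  shows "(\<Sum>y\<in>UNIV. of_bool (affine_act s y = affine_act g y))
    = (1 :: int) - of_bool (fst s = fst g) + int CARD('a) * of_bool (s = g)"
proof (cases "fst s = fst g")
  case True
  then show ?thesis by (auto simp: affine_act_def prod_eq_iff)
next
  case False
  then have "affine_act s y = affine_act g y \<longleftrightarrow> y = (snd g - snd s) / (fst s - fst g)" for y
    by (auto simp: affine_act_def field_simps)
  then show ?thesis using False by auto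
qed

text \<open>There are as many functionals here as group elements; triviality of their common kernel
  makes the change of basis matrix nonsingular.\<close>

lemma separating_functionals:
  fixes v :: "'a::{finite, field} \<times> 'a \<Rightarrow> int"
  assumes lin: "\<And>z. z \<noteq> 0 \<Longrightarrow> (\<Sum>g\<in>carrier GA1. of_bool (fst g = z) * v g) = 0"
    and pts: "\<And>y z. y \<noteq> 0 \<Longrightarrow> z \<noteq> 0 \<Longrightarrow>
      (\<Sum>g\<in>carrier GA1. point_diff z (affine_act g y) * v g) = 0"
    and s: "s \<in> carrier GA1"
  shows "v s = 0"
proof -
  define N where "N y z = (\<Sum>g\<in>carrier GA1. of_bool (affine_act g y = z) * v g)" for y z
  have total: "(\<Sum>g\<in>carrier GA1. v g) = 0"
  proof -
    have "(\<Sum>g\<in>carrier GA1. v g) = (\<Sum>g\<in>carrier GA1. \<Sum>z\<in>UNIV - {0}. of_bool (fst g = z) * v g)"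
      by (rule sum.cong[OF refl])
        (auto simp: carrier_GA1 of_bool_def if_distrib[of "\<lambda>x. x * _"] cong: if_cong)
    also have "\<dots> = (\<Sum>z\<in>UNIV - {0}. \<Sum>g\<in>carrier GA1. of_bool (fst g = z) * v g)"
      by (rule sum.swap)
    finally show ?thesis using lin by simp
  qed
  have sum_N: "(\<Sum>z\<in>UNIV. N y z) = 0" for y
    unfolding N_def using total
    by (subst sum.swap) (simp add: sum_distrib_right[symmetric])
  \<comment> \<open>For \<open>y\<close> nonzero, \<open>N y\<close> is constant in \<open>z\<close>
    and has sum 0, so it vanishes.\<close>
  have N_eq: "N y z = N y 0" if "y \<noteq> 0" for y z
    using pts[OF that, of z] by (cases "z = 0")
      (simp_all add: N_def point_diff_def left_diff_distrib sum_subtractf)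
  have N_units: "N y z = 0" if "y \<noteq> 0" for y z
  proof -
    have "(\<Sum>z\<in>UNIV. N y z) = (\<Sum>z\<in>(UNIV :: 'a set). N y 0)"
      by (intro sum.cong refl N_eq that)
    then show ?thesis using sum_N[of y] N_eq[OF that, of z] by simp
  qed
  \<comment> \<open>The base point 0 is reached through column sums: each group element sends
    exactly one point to \<open>z\<close>.\<close>
  have "N 0 z = (\<Sum>y\<in>UNIV. N y z)" for z
    using N_units by (subst sum.remove[of _ 0]) auto
  also have "(\<Sum>y\<in>UNIV. N y z) = (\<Sum>g\<in>carrier GA1. v g)" for z
  proof -
    have "(\<Sum>y\<in>UNIV. of_bool (affine_act g y = z)) = (1 :: int)" if "g \<in> carrier GA1" for g
    proof -
      have "affine_act g y = z \<longleftrightarrow> y = (z - snd g) / fst g" for y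
        using that by (auto simp: affine_act_def carrier_GA1 field_simps)
      then show ?thesis by simp
    qed
    then show ?thesis
      unfolding N_def by (subst sum.swap) (simp add: sum_distrib_right[symmetric])
  qed
  finally have N_zero: "N y z = 0" for y z
    using N_units total by (cases "y = 0") auto
  \<comment> \<open>Summing along the graph of \<open>s\<close> counts agreements with
    \<open>s\<close>, which isolates \<open>v s\<close> up to the factor q.\<close>
  have "0 = (\<Sum>y\<in>UNIV. N y (affine_act s y))" by (simp add: N_zero)
  also have "\<dots> = (\<Sum>g\<in>carrier GA1. (1 - of_bool (fst g = fst s) + int CARD('a) * of_bool (g = s)) * v g)"
    unfolding N_def by (subst sum.swap) (simp add: sum_distrib_right[symmetric] sum_agree)
  also have "\<dots> = (\<Sum>g\<in>carrier GA1. v g) - (\<Sum>g\<in>carrier GA1. of_bool (fst g = fst s) * v g)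
      + int CARD('a) * (\<Sum>g\<in>carrier GA1. of_bool (g = s) * v g)"
    by (simp add: distrib_right left_diff_distrib mult.assoc sum.distrib sum_subtractf
        sum_distrib_left[symmetric] del: sum_of_bool_mult_eq)
  also have "(\<Sum>g\<in>carrier GA1. of_bool (g = s) * v g) = v s"
    using s sum.delta[of "carrier GA1" s v]
    by (simp add: carrier_GA1 of_bool_def if_distrib[of "\<lambda>x. x * _"] cong: if_cong)
  moreover have "fst s \<noteq> 0" using s by (auto simp: carrier_GA1)
  ultimately show ?thesis using total lin[of "fst s"] by simp
qed

section \<open>Block diagonalisation and the determinant\<close>

text \<open>For fixed \<open>c\<close> the functionals span an invariant space. The value
  \<open>c = 0\<close> is the quotient by translations; each other \<open>c\<close> is a copy of the
  degree n representation with base point \<open>\<gamma> ^ (c - 1)\<close>, and all copies give the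
  same matrix.\<close>

lemma ga_coeffs_functional:
  fixes \<gamma> :: "'a::{finite, field}" and m r :: int and c i :: nat
  defines "n \<equiv> CARD('a) - 1"
  defines "\<phi> \<equiv> \<lambda>c z g. if c = 0 then of_bool (fst g = z) else point_diff z (affine_act g (\<gamma> ^ (c - 1)))"
  assumes one: "\<gamma> ^ n = 1" and gen: "bij_betw (\<lambda>j. \<gamma> ^ j) {0..<n} (UNIV - {0})"
    and i: "i < n" and g: "g \<in> carrier GA1"
  shows "(\<Sum>s\<in>carrier GA1. ga_coeffs \<gamma> m r s * \<phi> c (\<gamma> ^ i) (s \<otimes>\<^bsub>GA1\<^esub> g))
    = (\<Sum>j<n. (of_bool (i = j) - of_bool (i = Suc j mod n)
        + (if c = 0 then 1 else 1 - int CARD('a) * of_bool (i = 0))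
          * (m - (if c = 0 then 0 else int CARD('a) * r * of_bool (j = 0)))) * \<phi> c (\<gamma> ^ j) g)"
proof -
  let ?q = "int CARD('a)"
  have n: "n > 0" using i by simp
  have int_n: "int n = ?q - 1" using n unfolding n_def by simp
  have nz: "\<gamma> \<noteq> 0" using one n by (auto simp: power_0_left)
  then have pow_nz: "\<gamma> ^ j \<noteq> 0" for j by simp
  have inj: "\<gamma> ^ j = \<gamma> ^ l \<longleftrightarrow> j = l" if "j < n" "l < n" for j l
    using gen that by (auto simp: bij_betw_def inj_on_def)
  have index: "\<exists>l<n. h = \<gamma> ^ l" if "h \<noteq> 0" for h
  proof -
    have "h \<in> (\<lambda>j. \<gamma> ^ j) ` {0..<n}" using gen that by (simp add: bij_betw_def)
    then show ?thesis by auto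
  qed
  have power_Suc: "\<gamma> * \<gamma> ^ l = \<gamma> ^ (Suc l mod n)" if "l < n" for l
    using that one by (cases "Suc l = n") (simp_all flip: power_Suc)
  have power_one: "\<gamma> ^ j = 1 \<longleftrightarrow> j = 0" if "j < n" for j
    using inj[OF that n] by simp
  have delta: "(\<Sum>j<n. k j * of_bool (\<gamma> ^ l = \<gamma> ^ j)) = k l" if "l < n" for l and k :: "nat \<Rightarrow> int"
  proof -
    have "(\<Sum>j<n. k j * of_bool (\<gamma> ^ l = \<gamma> ^ j)) = (\<Sum>j<n. if j = l then k j else 0)"
      by (rule sum.cong) (use that inj in \<open>auto\<close>)
    then show ?thesis using that by simp
  qed
  have succ: "(\<gamma> * \<gamma> ^ l = \<gamma> ^ i) = (i = Suc l mod n)" if "l < n" for l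
    using inj[of "Suc l mod n" i] n i that by (auto simp: power_Suc)
  have eq: "(\<gamma> ^ l = \<gamma> ^ i) = (i = l)" if "l < n" for l
    using inj[OF that i] by auto
  show ?thesis
  proof (cases "c = 0")
    case True
    have "fst g \<noteq> 0" using g by (auto simp: carrier_GA1)
    then obtain l where l: "l < n" "fst g = \<gamma> ^ l" using index by blast
    have "(\<Sum>s\<in>carrier GA1. ga_coeffs \<gamma> m r s * \<phi> c (\<gamma> ^ i) (s \<otimes>\<^bsub>GA1\<^esub> g))
      = of_bool (i = l) - of_bool (i = Suc l mod n) + m"
      using True ga_coeffs_fst[OF nz pow_nz[of l] pow_nz[of i], of m r]
      by (simp add: \<phi>_def mult_GA1 l eq[OF l(1)] succ[OF l(1)] del: sum_mult_of_bool_eq)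
    then show ?thesis
      using True delta[OF l(1)] by (simp add: \<phi>_def l del: sum_mult_of_bool_eq)
  next
    case False
    define t where "t = affine_act g (\<gamma> ^ (c - 1))"
    let ?u = "1 - ?q * of_bool (i = 0)"
    let ?k = "\<lambda>j. of_bool (i = j) - of_bool (i = Suc j mod n) + ?u * (m - ?q * r * of_bool (j = 0))"
    have lhs: "(\<Sum>s\<in>carrier GA1. ga_coeffs \<gamma> m r s * \<phi> c (\<gamma> ^ i) (s \<otimes>\<^bsub>GA1\<^esub> g))
      = point_diff (\<gamma> ^ i) t - point_diff (\<gamma> ^ i) (\<gamma> * t)
        - ?u * ((m - r) * (?q * of_bool (t = 0) - 1) + r * (?q * of_bool (t = 1) - 1))"
      using False ga_coeffs_point_diff[OF nz pow_nz[of i], of m r t]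
      by (simp add: \<phi>_def affine_act_mult t_def power_one[OF i] algebra_simps
          del: sum_mult_of_bool_eq)
    have rhs: "(\<Sum>j<n. ?k j * \<phi> c (\<gamma> ^ j) g) = (\<Sum>j<n. ?k j * point_diff (\<gamma> ^ j) t)"
      using False by (simp add: \<phi>_def t_def)
    have "(\<Sum>j<n. ?k j * point_diff (\<gamma> ^ j) t) = point_diff (\<gamma> ^ i) t - point_diff (\<gamma> ^ i) (\<gamma> * t)
        - ?u * ((m - r) * (?q * of_bool (t = 0) - 1) + r * (?q * of_bool (t = 1) - 1))"
    proof (cases "t = 0")
      \<comment> \<open>At the point 0 every \<open>point_diff\<close> is -1, so the sum is minus a
        row sum of \<open>?k\<close>, in which identity and cycle cancel.\<close>
      case True
      have "(\<Sum>j<n. of_bool (i = j)) = (1 :: int)" using i by (simp add: of_bool_def)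
      moreover have "(\<Sum>j<n. of_bool (j = 0)) = (1 :: int)" using n by (simp add: of_bool_def)
      ultimately have "(\<Sum>j<n. ?k j) = ?u * (int n * m - ?q * r)"
        using sum_of_bool_cycle[OF i, where 'a = int]
        by (simp add: sum.distrib sum_subtractf sum_distrib_left[symmetric]
            del: sum_of_bool_eq)
      moreover have "(\<Sum>j<n. ?k j * point_diff (\<gamma> ^ j) t) = - (\<Sum>j<n. ?k j)"
        using True pow_nz nz by (simp only: sum_negf[symmetric]) (simp add: point_diff_def)
      ultimately show ?thesis
        using True nz by (simp add: int_n point_diff_def algebra_simps)
    next
      case False
      then obtain l where l: "l < n" "t = \<gamma> ^ l" using index by blast
      have "(\<Sum>j<n. ?k j * point_diff (\<gamma> ^ j) t) = ?k l"
        using delta[OF l(1), of ?k] pow_nz[of l] by (simp only: point_diff_def l(2)) simp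
      then show ?thesis
        using False nz by (simp add: point_diff_def succ[OF l(1)] l(2) eq[OF l(1)] power_one[OF l(1)])
          (simp add: algebra_simps)
    qed
    then show ?thesis using False lhs rhs by simp
  qed
qed

text \<open>The matrix \<open>T\<close> of functionals intertwines the group matrix \<open>M\<close>
  with the block diagonal \<open>D\<close>. Over the integers \<open>T\<close> need not be
  invertible, but its nonzero determinant cancels.\<close>

lemma group_det_ga_coeffs:
  fixes \<gamma> :: "'a::{finite, field}" and m r :: int
  defines "n \<equiv> CARD('a) - 1"
  assumes one: "\<gamma> ^ n = 1" and gen: "bij_betw (\<lambda>j. \<gamma> ^ j) {0..<n} (UNIV - {0})"
  shows "group_det GA1 (ga_coeffs \<gamma> m r) = int n ^ 2 * m * (int CARD('a) * r - int n * m) ^ n"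
proof -
  let ?q = "CARD('a)"
  interpret GA1: group "GA1 :: ('a \<times> 'a) monoid" by (rule group_GA1)
  have n: "n > 0"
    using card_mono[of "UNIV :: 'a set" "{0, 1}"] by (simp add: n_def)
  have q: "?q = Suc n" using n by (simp add: n_def)
  define N where "N = ?q * n"
  have "card (carrier (GA1 :: ('a \<times> 'a) monoid)) = N"
    by (simp add: carrier_GA1 card_cartesian_product N_def n_def mult.commute)
  moreover have fin: "finite (carrier (GA1 :: ('a \<times> 'a) monoid))" by simp
  ultimately obtain e :: "nat \<Rightarrow> 'a \<times> 'a" where e: "bij_betw e {0..<N} (carrier GA1)"
    using ex_bij_betw_nat_finite by metis
  define \<phi> :: "nat \<Rightarrow> 'a \<Rightarrow> 'a \<times> 'a \<Rightarrow> int" where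
    "\<phi> c z g = (if c = 0 then of_bool (fst g = z) else point_diff z (affine_act g (\<gamma> ^ (c - 1))))" for c z g
  define K where "K c i j = of_bool (i = j) - of_bool (i = Suc j mod n)
        + (if c = 0 then 1 else 1 - int ?q * of_bool (i = 0))
          * (m - (if c = 0 then 0 else int ?q * r * of_bool (j = 0)))" for c i j :: nat
  define M where "M = mat N N (\<lambda>(i, j). ga_coeffs \<gamma> m r (e i \<otimes>\<^bsub>GA1\<^esub> inv\<^bsub>GA1\<^esub> e j))"
  define T where "T = mat N N (\<lambda>(i, l). \<phi> (i div n) (\<gamma> ^ (i mod n)) (e l))"
  define D where "D = mat N N (\<lambda>(i, j). if i div n = j div n then K (i div n) (i mod n) (j mod n) else 0)"
  have carrier: "M \<in> carrier_mat N N" "T \<in> carrier_mat N N" "D \<in> carrier_mat N N"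
    by (simp_all add: M_def T_def D_def)
  have e_in: "e l \<in> carrier GA1" if "l < N" for l
    using e that by (auto simp: bij_betw_def)
  have "T * M = D * T"
  proof (rule eq_matI, goal_cases)
    case (1 i l)
    then have il: "i < N" "l < N" by (auto simp: D_def T_def)
    let ?c = "i div n" and ?i = "i mod n" and ?g = "e l"
    have i: "?i < n" using n by simp
    have c: "?c < ?q" using il(1) unfolding N_def by (rule less_mult_imp_div_less)
    have "(T * M) $$ (i, l) = (\<Sum>k = 0..<N. \<phi> ?c (\<gamma> ^ ?i) (e k) * ga_coeffs \<gamma> m r (e k \<otimes>\<^bsub>GA1\<^esub> inv\<^bsub>GA1\<^esub> ?g))"
      using il by (simp add: T_def M_def scalar_prod_def)
    also have "\<dots> = (\<Sum>s\<in>carrier GA1. \<phi> ?c (\<gamma> ^ ?i) s * ga_coeffs \<gamma> m r (s \<otimes>\<^bsub>GA1\<^esub> inv\<^bsub>GA1\<^esub> ?g))"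
      by (rule sum.reindex_bij_betw[OF e])
    \<comment> \<open>Replacing \<open>s\<close> by its product with \<open>?g\<close> moves the
      translation from the coefficient to the functional.\<close>
    also have "\<dots> = (\<Sum>s\<in>carrier GA1. ga_coeffs \<gamma> m r s * \<phi> ?c (\<gamma> ^ ?i) (s \<otimes>\<^bsub>GA1\<^esub> ?g))"
      by (rule sum.reindex_bij_witness[of _ "\<lambda>s. s \<otimes>\<^bsub>GA1\<^esub> ?g" "\<lambda>s. s \<otimes>\<^bsub>GA1\<^esub> inv\<^bsub>GA1\<^esub> ?g"])
        (use e_in[OF il(2)] in \<open>auto simp: GA1.m_assoc\<close>)
    also have "\<dots> = (\<Sum>j<n. K ?c ?i j * \<phi> ?c (\<gamma> ^ j) ?g)"
      unfolding K_def \<phi>_def n_def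
      by (rule ga_coeffs_functional) (use one gen i e_in[OF il(2)] in \<open>simp_all add: n_def\<close>)
    also have "\<dots> = (\<Sum>k<N. if ?c = k div n then K ?c ?i (k mod n) * \<phi> ?c (\<gamma> ^ (k mod n)) ?g else 0)"
    proof -
      have "(\<Sum>k<N. if ?c = k div n then K ?c ?i (k mod n) * \<phi> ?c (\<gamma> ^ (k mod n)) ?g else 0)
        = (\<Sum>k\<in>{k\<in>{..<N}. ?c = k div n}. K ?c ?i (k mod n) * \<phi> ?c (\<gamma> ^ (k mod n)) ?g)"
        by (rule sum.inter_filter[symmetric]) simp
      also have "\<dots> = (\<Sum>j<n. K ?c ?i j * \<phi> ?c (\<gamma> ^ j) ?g)"
      proof (rule sum.reindex_bij_witness[of _ "\<lambda>j. ?c * n + j" "\<lambda>k. k mod n"])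
        fix j assume "j \<in> {..<n}"
        then have j: "j < n" by simp
        have "?c * n + j < Suc ?c * n" using j by simp
        also have "\<dots> \<le> N" unfolding N_def using c by (intro mult_right_mono) auto
        finally show "?c * n + j \<in> {k\<in>{..<N}. ?c = k div n}" using j by simp
      qed (use n in auto)
      finally show ?thesis ..
    qed
    also have "\<dots> = (D * T) $$ (i, l)"
      using il by (simp add: D_def T_def scalar_prod_def lessThan_atLeast0 if_distrib[of "\<lambda>x. x * _"] cong: if_cong)
    finally show ?case .
  qed (simp_all add: M_def T_def D_def)
  then have "det (T * M) = det (D * T)" by simp
  then have "det T * det M = det D * det T"
    by (simp add: det_mult[OF carrier(2,1)] det_mult[OF carrier(3,2)])
  moreover have "det T \<noteq> 0"
  proof
    assume "det T = 0"
    then obtain v where v: "v \<in> carrier_vec N" "v \<noteq> 0\<^sub>v N" "T *\<^sub>v v = 0\<^sub>v N"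
      using det_0_iff_vec_prod_zero[OF carrier(2)] by blast
    \<comment> \<open>A kernel vector, read as a function on the group, is annihilated by every
      functional.\<close>
    define w where "w g = v $ inv_into {0..<N} e g" for g
    have w: "w (e l) = v $ l" if "l < N" for l
      using e that by (simp add: w_def bij_betw_def inv_into_f_f)
    have ann: "(\<Sum>g\<in>carrier GA1. \<phi> c (\<gamma> ^ j) g * w g) = 0" if "c < ?q" "j < n" for c j
    proof -
      have "c * n + j < Suc c * n" using that by simp
      also have "\<dots> \<le> N" unfolding N_def using that by (intro mult_right_mono) auto
      finally have i: "c * n + j < N" .
      have "(\<Sum>g\<in>carrier GA1. \<phi> c (\<gamma> ^ j) g * w g) = (\<Sum>l = 0..<N. \<phi> c (\<gamma> ^ j) (e l) * w (e l))"
        by (rule sum.reindex_bij_betw[OF e, symmetric])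
      also have "\<dots> = (T *\<^sub>v v) $ (c * n + j)"
        using i that v(1) by (auto simp: T_def scalar_prod_def w intro!: sum.cong)
      finally show ?thesis using v(3) i by simp
    qed
    have index: "\<exists>l<n. h = \<gamma> ^ l" if "h \<noteq> 0" for h
    proof -
    have "h \<in> (\<lambda>j. \<gamma> ^ j) ` {0..<n}" using gen that by (simp add: bij_betw_def)
    then show ?thesis by auto
  qed
    have "w s = 0" if "s \<in> carrier GA1" for s
    proof (rule separating_functionals[OF _ _ that])
      fix z :: 'a assume "z \<noteq> 0"
      with index obtain j where j: "j < n" "z = \<gamma> ^ j" by blast
      show "(\<Sum>g\<in>carrier GA1. of_bool (fst g = z) * w g) = 0"
        using ann[of 0 j] j q by (simp add: \<phi>_def)
      fix y :: 'a assume "y \<noteq> 0"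
      with index obtain d where d: "d < n" "y = \<gamma> ^ d" by blast
      show "(\<Sum>g\<in>carrier GA1. point_diff z (affine_act g y) * w g) = 0"
        using ann[of "Suc d" j] j d q by (simp add: \<phi>_def)
    qed
    then have "v $ l = 0" if "l < N" for l using w[OF that] e_in[OF that] by simp
    then have "v = 0\<^sub>v N" using v(1) by (intro eq_vecI) auto
    with v(2) show False by simp
  qed
  ultimately have "det M = det D" by simp
  also have "\<dots> = (\<Prod>c<?q. det (mat n n (\<lambda>(i, j). K c i j)))"
    unfolding D_def N_def by (rule det_block_diagonal)
  \<comment> \<open>In block 0 the sums of u and w are n and n m; in the others they are n - q = -1
    and n m - q r.\<close>
  also have "\<dots> = (\<Prod>c<?q. if c = 0 then int n * (int n * m) else int ?q * r - int n * m)"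
  proof (rule prod.cong[OF refl])
    fix c
    have delta: "(\<Sum>j<n. of_bool (j = 0)) = (1 :: int)" using n by (simp add: of_bool_def)
    show "det (mat n n (\<lambda>(i, j). K c i j))
      = (if c = 0 then int n * (int n * m) else int ?q * r - int n * m)"
      unfolding K_def det_one_minus_cycle_plus_rank_one[OF n]
      by (simp add: sum_subtractf sum_distrib_left[symmetric] delta del: sum_of_bool_eq)
        (simp add: q)
  qed
  also have "\<dots> = int n ^ 2 * m * (int ?q * r - int n * m) ^ n"
    unfolding q prod.lessThan_Suc_shift by (simp add: power2_eq_square)
  finally show ?thesis
    unfolding M_def group_det_eq_det[OF e] .
qed

theorem theorem3:
  fixes p k :: nat and A B :: int
  assumes "prime p" and "k \<ge> 1"
    and "card (UNIV :: 'a set) = p ^ k"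
    and "(int (p ^ k) - 1)^2 dvd A"
    and "[B = A] (mod int (p ^ k))"
  shows "integer_group_det (GA1 :: ('a::{finite, field} \<times> 'a) monoid) (A * B ^ (p ^ k - 1))"
proof -
  define n where "n = CARD('a) - 1"
  obtain \<gamma> :: 'a where \<gamma>: "\<gamma> ^ n = 1" "bij_betw (\<lambda>j. \<gamma> ^ j) {0..<n} (UNIV - {0})"
    unfolding n_def by (rule finite_field_generator)
  have q: "p ^ k = CARD('a)" using assms(3) by simp
  have int_n: "int n = int CARD('a) - 1"
    unfolding n_def by (simp add: of_nat_diff Suc_leI)
  obtain m where m: "A = int n ^ 2 * m" using assms(4) unfolding q int_n by (auto elim: dvdE)
  have "int CARD('a) dvd B - A" using assms(5) unfolding q by (simp add: cong_iff_dvd_diff)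
  \<comment> \<open>Since n + 1 = q, \<open>A + int n * m\<close> equals q n m, so B is congruent to
    -n m modulo q.\<close>
  moreover have "B + int n * m = (B - A) + int CARD('a) * (int n * m)"
    unfolding m int_n by (simp add: power2_eq_square algebra_simps)
  ultimately have "int CARD('a) dvd B + int n * m" by (simp only: dvd_add dvd_triv_left)
  then obtain r where r: "B + int n * m = int CARD('a) * r" by (rule dvdE)
  then have "B = int CARD('a) * r - int n * m" by simp
  then have "A * B ^ (p ^ k - 1) = group_det GA1 (ga_coeffs \<gamma> m r)"
    using group_det_ga_coeffs[of \<gamma> m r] \<gamma> by (simp add: m q n_def)
  then show ?thesis unfolding integer_group_det_def by blast
qed

end
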